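(* $\mathbb{CE}_2^{\mathrm{HS}}$ is a suboperad of $\mathbb{CE}_2^{\mathrm{emb}}$.
   Context: $\mathbb D=\{z\in\mathbb C:|z|<1\}$. $\mathbb{CE}_2^{\mathrm{emb}}(1)$ is the set of injective holomorphic maps $\mathbb D\to\mathbb D$; for $n\ge0$, $\mathbb{CE}_2^{\mathrm{emb}}(n)=\{(\phi_1,\dots,\phi_n)\in\mathbb{CE}_2^{\mathrm{emb}}(1)^n:\phi_i(\mathbb D)\cap\phi_j(\mathbb D)=\emptyset\text{ for }i\neq j\}$, with $\mathbb{CE}_2^{\mathrm{emb}}(0)=\{*\}$. It is a (symmetric) operad: $S_n$ permutes entries, the unit is $\mathrm{id}_{\mathbb D}$, $(f_1,\dots,f_n)\circ_i(g_1,\dots,g_m)=(f_1,\dots,f_{i-1},f_i\circ g_1,\dots,f_i\circ g_m,f_{i+1},\dots,f_n)$, and $(f_1,\dots,f_n)\circ_i*=(f_1,\dots,f_{i-1},f_{i+1},\dots,f_n)$. For $\phi\in\mathbb{CE}_2^{\mathrm{emb}}(1)$, $F_\phi(z,w)=\frac{\phi'(z)\phi'(w)}{(\phi(z)-\phi(w))^2}-\frac1{(z-w)^2}$, and for $(\phi_1,\phi_2)\in\mathbb{CE}_2^{\mathrm{emb}}(2)$, $G_{\phi_1,\phi_2}(z,w)=\frac{\phi_1'(z)\phi_2'(w)}{(\phi_1(z)-\phi_2(w))^2}$; both are holomorphic on $\mathbb D\times\mathbb D$. $\mathbb{CE}_2^{\mathrm{HS}}(1)=\{\phi\in\mathbb{CE}_2^{\mathrm{emb}}(1):F_\phi\in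 L^2(\mathbb D\times\mathbb D)\}$ and, for $n\ge0$, $\mathbb{CE}_2^{\mathrm{HS}}(n)=\{(\phi_1,\dots,\phi_n)\in\mathbb{CE}_2^{\mathrm{HS}}(1)^n\cap\mathbb{CE}_2^{\mathrm{emb}}(n):G_{\phi_i,\phi_j}\in L^2(\mathbb D\times\mathbb D)\text{ for any }i\ne j\}$ (so $\mathbb{CE}_2^{\mathrm{HS}}(0)=\{*\}$). $L^2$ is with respect to Lebesgue measure. *)

theory Defs
  imports
    "HOL-Analysis.Analysis"
    "HOL-Combinatorics.List_Permutation"
begin

section \<open>Symmetric operads of sets and suboperads\<close>

text \<open>Symmetric operads are given by partial compositions.  Inputs are numbered from \<open>0\<close>, and
  permutations act from the right.  The operations take the arities as arguments, because the
  sets \<open>P n\<close> need not be disjoint: \<open>pcomp n m i f g\<close> is \<open>f \<circ>\<^sub>i g\<close> for \<open>f \<in> P n\<close> and \<open>g \<in> P m\<close>,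
  and \<open>act n \<sigma> f\<close> is \<open>f \<cdot> \<sigma>\<close> for \<open>f \<in> P n\<close>.

  The input \<open>k \<noteq> i\<close> of \<open>f\<close> becomes the input \<open>shift_input m i k\<close> of \<open>f \<circ>\<^sub>i g\<close> (\<open>m\<close> the arity of \<open>g\<close>),
  and \<open>perm_comp m i \<sigma> \<tau>\<close> is the permutation with
  \<open>(f \<cdot> \<sigma>) \<circ>\<^sub>i (g \<cdot> \<tau>) = (f \<circ>\<^bsub>\<sigma> i\<^esub> g) \<cdot> perm_comp m i \<sigma> \<tau>\<close>.\<close>

definition shift_input :: "nat \<Rightarrow> nat \<Rightarrow> nat \<Rightarrow> nat" where
  "shift_input m i k = (if k < i then k else k + m - 1)"

definition perm_comp ::
    "nat \<Rightarrow> nat \<Rightarrow> (nat \<Rightarrow> nat) \<Rightarrow> (nat \<Rightarrow> nat) \<Rightarrow> nat \<Rightarrow> nat" where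
  "perm_comp m i \<sigma> \<tau> p =
     (if p < i then shift_input m (\<sigma> i) (\<sigma> p)
      else if p < i + m then \<sigma> i + \<tau> (p - i)
      else shift_input m (\<sigma> i) (\<sigma> (p + 1 - m)))"

locale symmetric_operad =
  fixes P :: "nat \<Rightarrow> 'a set"
    and act :: "nat \<Rightarrow> (nat \<Rightarrow> nat) \<Rightarrow> 'a \<Rightarrow> 'a"
    and unit :: 'a
    and pcomp :: "nat \<Rightarrow> nat \<Rightarrow> nat \<Rightarrow> 'a \<Rightarrow> 'a \<Rightarrow> 'a"
  assumes unit_closed: "unit \<in> P 1"
    and act_closed: "\<lbrakk>\<sigma> permutes {..<n}; f \<in> P n\<rbrakk> \<Longrightarrow> act n \<sigma> f \<in> P n"
    and pcomp_closed: "\<lbrakk>i < n; f \<in> P n; g \<in> P m\<rbrakk> \<Longrightarrow> pcomp n m i f g \<in> P (n + m - 1)"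
    and act_id: "f \<in> P n \<Longrightarrow> act n id f = f"
    and act_comp: "\<lbrakk>\<sigma> permutes {..<n}; \<tau> permutes {..<n}; f \<in> P n\<rbrakk>
          \<Longrightarrow> act n (\<sigma> \<circ> \<tau>) f = act n \<tau> (act n \<sigma> f)"
    and unit_left: "g \<in> P m \<Longrightarrow> pcomp 1 m 0 unit g = g"
    and unit_right: "\<lbrakk>i < n; f \<in> P n\<rbrakk> \<Longrightarrow> pcomp n 1 i f unit = f"
    and assoc_sequential: "\<lbrakk>i < l; j < m; f \<in> P l; g \<in> P m; h \<in> P n\<rbrakk>
          \<Longrightarrow> pcomp (l + m - 1) n (i + j) (pcomp l m i f g) h
            = pcomp l (m + n - 1) i f (pcomp m n j g h)"
    and assoc_parallel: "\<lbrakk>i < k; k < l; f \<in> P l; g \<in> P m; h \<in> P n\<rbrakk>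
          \<Longrightarrow> pcomp (l + m - 1) n (k + m - 1) (pcomp l m i f g) h
            = pcomp (l + n - 1) m i (pcomp l n k f h) g"
    and equivariant: "\<lbrakk>i < n; \<sigma> permutes {..<n}; \<tau> permutes {..<m}; f \<in> P n; g \<in> P m\<rbrakk>
          \<Longrightarrow> pcomp n m i (act n \<sigma> f) (act m \<tau> g)
            = act (n + m - 1) (perm_comp m i \<sigma> \<tau>) (pcomp n m (\<sigma> i) f g)"

locale suboperad = symmetric_operad P act unit pcomp
  for Q P :: "nat \<Rightarrow> 'a set"
    and act :: "nat \<Rightarrow> (nat \<Rightarrow> nat) \<Rightarrow> 'a \<Rightarrow> 'a"
    and unit :: 'a
    and pcomp :: "nat \<Rightarrow> nat \<Rightarrow> nat \<Rightarrow> 'a \<Rightarrow> 'a \<Rightarrow> 'a" +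
  assumes sub_subset: "Q n \<subseteq> P n"
    and sub_unit: "unit \<in> Q 1"
    and sub_act: "\<lbrakk>\<sigma> permutes {..<n}; f \<in> Q n\<rbrakk> \<Longrightarrow> act n \<sigma> f \<in> Q n"
    and sub_pcomp: "\<lbrakk>i < n; f \<in> Q n; g \<in> Q m\<rbrakk> \<Longrightarrow> pcomp n m i f g \<in> Q (n + m - 1)"


section \<open>The operad of disjoint holomorphic embeddings of the disk\<close>

abbreviation disk :: "complex set" where
  "disk \<equiv> ball 0 1"

text \<open>A map on the disk is represented by the function that is \<open>undefined\<close> outside the disk, so that
  equality of functions is equality of maps on the disk.\<close>

definition disk_emb :: "(complex \<Rightarrow> complex) set" where
  "disk_emb = {\<phi> \<in> extensional disk. \<phi> holomorphic_on disk \<and> inj_on \<phi> disk \<and> \<phi> ` disk \<subseteq> disk}"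

definition CE_emb :: "nat \<Rightarrow> (complex \<Rightarrow> complex) list set" where
  "CE_emb n = {\<phi>s. length \<phi>s = n \<and> set \<phi>s \<subseteq> disk_emb \<and>
     (\<forall>i<n. \<forall>j<n. i \<noteq> j \<longrightarrow> (\<phi>s ! i) ` disk \<inter> (\<phi>s ! j) ` disk = {})}"

definition CE_act ::
    "nat \<Rightarrow> (nat \<Rightarrow> nat) \<Rightarrow> (complex \<Rightarrow> complex) list \<Rightarrow> (complex \<Rightarrow> complex) list" where
  "CE_act n \<sigma> fs = permute_list \<sigma> fs"

definition CE_unit :: "(complex \<Rightarrow> complex) list" where
  "CE_unit = [restrict id disk]"

definition CE_pcomp :: "nat \<Rightarrow> nat \<Rightarrow> nat
    \<Rightarrow> (complex \<Rightarrow> complex) list \<Rightarrow> (complex \<Rightarrow> complex) list \<Rightarrow> (complex \<Rightarrow> complex) list" where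
  "CE_pcomp n m i fs gs = take i fs @ map (compose disk (fs ! i)) gs @ drop (i + 1) fs"


section \<open>The Hilbert--Schmidt condition\<close>

definition square_integrable_on ::
    "('a::euclidean_space \<Rightarrow> complex) \<Rightarrow> 'a set \<Rightarrow> bool" (infix \<open>square'_integrable'_on\<close> 50) where
  "f square_integrable_on A \<longleftrightarrow>
     f \<in> borel_measurable (lebesgue_on A) \<and> integrable (lebesgue_on A) (\<lambda>x. (norm (f x))\<^sup>2)"

text \<open>On the diagonal, where the formula for \<open>F\<close> has a removable singularity, \<open>HS_F\<close> has the value
  \<open>0\<close> (as \<open>x / 0 = 0\<close>) instead of that of the holomorphic extension.  The diagonal is a null set of
  \<open>\<complex> \<times> \<complex>\<close>, so square integrability is not affected.\<close>

definition HS_F :: "(complex \<Rightarrow> complex) \<Rightarrow> complex \<times> complex \<Rightarrow> complex" where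
  "HS_F \<phi> = (\<lambda>(z, w). deriv \<phi> z * deriv \<phi> w / (\<phi> z - \<phi> w)\<^sup>2 - 1 / (z - w)\<^sup>2)"

definition HS_G ::
    "(complex \<Rightarrow> complex) \<Rightarrow> (complex \<Rightarrow> complex) \<Rightarrow> complex \<times> complex \<Rightarrow> complex" where
  "HS_G \<phi> \<psi> = (\<lambda>(z, w). deriv \<phi> z * deriv \<psi> w / (\<phi> z - \<psi> w)\<^sup>2)"

definition disk_HS :: "(complex \<Rightarrow> complex) set" where
  "disk_HS = {\<phi> \<in> disk_emb. HS_F \<phi> square_integrable_on disk \<times> disk}"

definition CE_HS :: "nat \<Rightarrow> (complex \<Rightarrow> complex) list set" where
  "CE_HS n = {\<phi>s \<in> CE_emb n. set \<phi>s \<subseteq> disk_HS \<and>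
     (\<forall>i<n. \<forall>j<n. i \<noteq> j \<longrightarrow> HS_G (\<phi>s ! i) (\<phi>s ! j) square_integrable_on disk \<times> disk)}"

section \<open>The operad axioms\<close>

lemma disk_emb_mem: "\<phi> \<in> disk_emb \<Longrightarrow> z \<in> disk \<Longrightarrow> \<phi> z \<in> disk"
  unfolding disk_emb_def by blast

lemma CE_emb_nth: "fs \<in> CE_emb n \<Longrightarrow> i < n \<Longrightarrow> fs ! i \<in> disk_emb"
  unfolding CE_emb_def using nth_mem by blast

lemma CE_emb_length: "fs \<in> CE_emb n \<Longrightarrow> length fs = n"
  unfolding CE_emb_def by blast

lemma CE_embI:
  assumes "length fs = n" "\<And>i. i < n \<Longrightarrow> fs ! i \<in> disk_emb"
    "\<And>i j z w. \<lbrakk>i < n; j < n; i \<noteq> j; z \<in> disk; w \<in> disk\<rbrakk> \<Longrightarrow> (fs ! i) z \<noteq> (fs ! j) w"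
  shows "fs \<in> CE_emb n"
  using assms unfolding CE_emb_def by (fastforce simp: in_set_conv_nth)

lemma CE_emb_disjoint:
  "\<lbrakk>fs \<in> CE_emb n; i < n; j < n; i \<noteq> j; z \<in> disk; w \<in> disk\<rbrakk> \<Longrightarrow> (fs ! i) z \<noteq> (fs ! j) w"
  unfolding CE_emb_def by blast

lemma disk_embI:
  assumes "\<phi> \<in> extensional disk" "\<phi> holomorphic_on disk"
    "\<And>z. z \<in> disk \<Longrightarrow> \<phi> z \<in> disk"
    "\<And>z w. \<lbrakk>z \<in> disk; w \<in> disk; \<phi> z = \<phi> w\<rbrakk> \<Longrightarrow> z = w"
  shows "\<phi> \<in> disk_emb"
  unfolding disk_emb_def using assms(1,2) inj_onI[of disk \<phi>, OF assms(4)] assms(3) by blast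

lemma disk_emb_inj: "\<lbrakk>\<phi> \<in> disk_emb; z \<in> disk; w \<in> disk; \<phi> z = \<phi> w\<rbrakk> \<Longrightarrow> z = w"
  unfolding disk_emb_def inj_on_def by blast

lemma restrict_id_disk_emb: "restrict id disk \<in> disk_emb"
proof (rule disk_embI)
  show "restrict id disk holomorphic_on disk"
    by (rule holomorphic_transform[OF holomorphic_on_id]) simp
qed (simp_all del: mem_ball mem_ball_0)

lemma compose_disk_emb:
  assumes \<phi>: "\<phi> \<in> disk_emb" and \<psi>: "\<psi> \<in> disk_emb"
  shows "compose disk \<phi> \<psi> \<in> disk_emb"
proof (rule disk_embI)
  have "(\<phi> \<circ> \<psi>) holomorphic_on disk"
    by (rule holomorphic_on_compose_gen[of _ _ _ disk]) (use \<phi> \<psi> in \<open>simp_all add: disk_emb_def\<close>)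
  then show "compose disk \<phi> \<psi> holomorphic_on disk"
    by (rule holomorphic_transform) (simp add: compose_def)
  show "compose disk \<phi> \<psi> \<in> extensional disk"
    by (rule compose_extensional)
  show "compose disk \<phi> \<psi> z \<in> disk" if "z \<in> disk" for z
    using disk_emb_mem[OF \<phi> disk_emb_mem[OF \<psi> that]] that by (simp add: compose_eq)
  show "z = w" if "z \<in> disk" "w \<in> disk" "compose disk \<phi> \<psi> z = compose disk \<phi> \<psi> w" for z w
    using disk_emb_inj[OF \<phi> disk_emb_mem[OF \<psi> that(1)] disk_emb_mem[OF \<psi> that(2)]]
      disk_emb_inj[OF \<psi> that(1,2)] that by (simp add: compose_eq)
qed

lemma CE_pcomp_length:
  "\<lbrakk>length fs = n; length gs = m; i < n\<rbrakk> \<Longrightarrow> length (CE_pcomp n' m' i fs gs) = n + m - 1"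
  by (simp add: CE_pcomp_def)

lemma CE_pcomp_nth:
  assumes "length fs = n" "length gs = m" "i < n" "p < n + m - 1"
  shows "CE_pcomp n' m' i fs gs ! p =
    (if p < i then fs ! p
     else if p < i + m then compose disk (fs ! i) (gs ! (p - i))
     else fs ! (p + 1 - m))"
  using assms by (auto simp: CE_pcomp_def nth_append intro!: arg_cong[of _ _ "(!) fs"])

lemma CE_pcomp_closed:
  assumes i: "i < n" and f: "f \<in> CE_emb n" and g: "g \<in> CE_emb m"
  shows "CE_pcomp n m i f g \<in> CE_emb (n + m - 1)"
proof (rule CE_embI)
  note len = CE_emb_length[OF f] CE_emb_length[OF g]
  note nth = CE_pcomp_nth[OF len i]
  show "length (CE_pcomp n m i f g) = n + m - 1"
    using CE_pcomp_length[OF len i] .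
  show "CE_pcomp n m i f g ! p \<in> disk_emb" if "p < n + m - 1" for p
    using that i by (auto simp: nth intro!: compose_disk_emb CE_emb_nth[OF f] CE_emb_nth[OF g])
  have inj: "x = y" if "(f ! i) x = (f ! i) y" "x \<in> disk" "y \<in> disk" for x y
    using CE_emb_nth[OF f i] that unfolding disk_emb_def inj_on_def by blast
  have mem: "(g ! k) z \<in> disk" if "k < m" "z \<in> disk" for k z
    using disk_emb_mem CE_emb_nth[OF g] that by blast
  show "(CE_pcomp n m i f g ! p) z \<noteq> (CE_pcomp n m i f g ! q) w"
    if pq: "p < n + m - 1" "q < n + m - 1" "p \<noteq> q" and zw: "z \<in> disk" "w \<in> disk" for p q z w
  proof (cases "p \<in> {i..<i+m} \<and> q \<in> {i..<i+m}")
    case True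
    then have "(g ! (p - i)) z \<noteq> (g ! (q - i)) w"
      using pq zw by (intro CE_emb_disjoint[OF g]) auto
    moreover have "(g ! (p - i)) z \<in> disk" "(g ! (q - i)) w \<in> disk"
      using True zw by (auto intro!: mem simp del: mem_ball mem_ball_0)
    ultimately have "(f ! i) ((g ! (p - i)) z) \<noteq> (f ! i) ((g ! (q - i)) w)"
      using inj by blast
    then show ?thesis
      using True pq zw by (simp add: nth compose_def)
  next
    case False
    define r where "r p = (if p < i then p else if p < i + m then i else p + 1 - m)" for p
    define u where "u p z = (if p < i then z else if p < i + m then (g ! (p - i)) z else z)" for p z
    have *: "(CE_pcomp n m i f g ! p) z = (f ! r p) (u p z) \<and> r p < n \<and> u p z \<in> disk"
      if "p < n + m - 1" "z \<in> disk" for p z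
      using that i mem[of "p - i" z] by (auto simp: nth r_def u_def compose_def)
    have "r p \<noteq> r q"
      using False pq i by (auto simp: r_def split: if_splits)
    then show ?thesis
      using * pq zw CE_emb_disjoint[OF f] by metis
  qed
qed

lemma perm_comp_less:
  assumes i: "i < n" and \<sigma>: "\<sigma> permutes {..<n}" and \<tau>: "\<tau> permutes {..<m}" and p: "p < n + m - 1"
  shows "perm_comp m i \<sigma> \<tau> p < n + m - 1"
proof -
  have s: "\<sigma> k < n" if "k < n" for k using permutes_in_image[OF \<sigma>] that by simp
  have t: "\<tau> k < m" if "k < m" for k using permutes_in_image[OF \<tau>] that by simp
  have ne: "\<sigma> k \<noteq> \<sigma> i" if "k \<noteq> i" for k
    using permutes_inj[OF \<sigma>] that by (auto dest: injD)
  have shift: "shift_input m (\<sigma> i) (\<sigma> k) < n + m - 1" if "k \<noteq> i" "k < n" for k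
    using s[OF that(2)] s[OF i] ne[OF that(1)] by (auto simp: shift_input_def)
  consider "p < i" | "i \<le> p" "p < i + m" | "i + m \<le> p" by linarith
  then show ?thesis
  proof cases
    case 1 then show ?thesis using shift[of p] i by (simp add: perm_comp_def)
  next
    case 2
    then have "p - i < m" by linarith
    with 2 show ?thesis using t[of "p - i"] s[OF i] by (simp add: perm_comp_def)
  next
    case 3
    then have "p + 1 - m \<noteq> i" "p + 1 - m < n" using p by linarith+
    with 3 show ?thesis using shift[of "p + 1 - m"] by (simp add: perm_comp_def)
  qed
qed

lemma perm_comp_permutes:
  assumes i: "i < n" and \<sigma>: "\<sigma> permutes {..<n}" and \<tau>: "\<tau> permutes {..<m}"
  shows "perm_comp m i \<sigma> \<tau> permutes {..<n + m - 1}"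
proof -
  have ne: "\<sigma> k = \<sigma> l \<longleftrightarrow> k = l" for k l
    using permutes_inj[OF \<sigma>] by (auto dest: injD)
  have te: "\<tau> k = \<tau> l \<longleftrightarrow> k = l" for k l
    using permutes_inj[OF \<tau>] by (auto dest: injD)
  have t: "\<tau> k < m" if "k < m" for k using permutes_in_image[OF \<tau>] that by simp
  have inj: "inj_on (perm_comp m i \<sigma> \<tau>) {..<n + m - 1}"
  proof (rule inj_onI)
    fix p q assume pq: "p \<in> {..<n + m - 1}" "q \<in> {..<n + m - 1}"
      and eq: "perm_comp m i \<sigma> \<tau> p = perm_comp m i \<sigma> \<tau> q"
    have in_block: "perm_comp m i \<sigma> \<tau> p \<in> {\<sigma> i..<\<sigma> i + m} \<longleftrightarrow> p \<in> {i..<i + m}" for p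
      using t[of "p - i"] ne[of p i] ne[of "p + 1 - m" i]
      by (auto simp: perm_comp_def shift_input_def)
    have inj_shift: "k = l" if "shift_input m (\<sigma> i) k = shift_input m (\<sigma> i) l" "k \<noteq> \<sigma> i" "l \<noteq> \<sigma> i" for k l
      using that by (auto simp: shift_input_def split: if_splits)
    show "p = q"
    proof (cases "p \<in> {i..<i + m}")
      case True
      then have "q \<in> {i..<i + m}" using in_block eq by metis
      then show ?thesis using True eq te[of "p - i" "q - i"] by (auto simp: perm_comp_def)
    next
      case False
      then have F: "q \<notin> {i..<i + m}" using in_block eq by metis
      define r where "r p = (if p < i then p else p + 1 - m)" for p
      have r: "r p \<noteq> i" "r q \<noteq> i" using False F by (auto simp: r_def)
      have "shift_input m (\<sigma> i) (\<sigma> (r p)) = shift_input m (\<sigma> i) (\<sigma> (r q))"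
        using eq False F by (auto simp: perm_comp_def r_def split: if_splits)
      then have "r p = r q" using inj_shift ne r by metis
      then show ?thesis using False F by (auto simp: r_def split: if_splits)
    qed
  qed
  have sub: "perm_comp m i \<sigma> \<tau> ` {..<n + m - 1} \<subseteq> {..<n + m - 1}"
    using perm_comp_less[OF assms] by auto
  have "bij_betw (perm_comp m i \<sigma> \<tau>) {..<n + m - 1} {..<n + m - 1}"
    using inj sub endo_inj_surj[of "{..<n + m - 1}"] by (auto simp: bij_betw_def)
  moreover have "perm_comp m i \<sigma> \<tau> p = p" if "p \<notin> {..<n + m - 1}" for p
  proof -
    have "\<sigma> (p + 1 - m) = p + 1 - m"
      using that i permutes_not_in[OF \<sigma>] by auto
    moreover have "\<sigma> i < n" using permutes_in_image[OF \<sigma>] i by simp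
    ultimately show ?thesis
      using that i by (auto simp: perm_comp_def shift_input_def)
  qed
  ultimately show ?thesis by (rule bij_imp_permutes)
qed

lemma CE_act_nth:
  "\<lbrakk>length fs = n; p < n\<rbrakk> \<Longrightarrow> CE_act n' \<sigma> fs ! p = fs ! \<sigma> p"
  by (simp add: CE_act_def permute_list_def)

lemma CE_act_length: "length (CE_act n \<sigma> fs) = length fs"
  by (simp add: CE_act_def)

lemma compose_disk_assoc:
  assumes "\<omega> \<in> disk_emb"
  shows "compose disk \<phi> (compose disk \<psi> \<omega>) = compose disk (compose disk \<phi> \<psi>) \<omega>"
  by (rule compose_assoc) (use disk_emb_mem[OF assms] in auto)

lemma CE_emb_operad: "symmetric_operad CE_emb CE_act CE_unit CE_pcomp"
proof
  show "CE_unit \<in> CE_emb 1"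
    using restrict_id_disk_emb by (simp add: CE_unit_def CE_emb_def)
next
  fix \<sigma> n f assume \<sigma>: "\<sigma> permutes {..<n}" and f: "f \<in> CE_emb n"
  have s: "\<sigma> k < n" if "k < n" for k using permutes_in_image[OF \<sigma>] that by simp
  have ne: "\<sigma> k \<noteq> \<sigma> l" if "k \<noteq> l" for k l
    using permutes_inj[OF \<sigma>] that by (auto dest: injD)
  show "CE_act n \<sigma> f \<in> CE_emb n"
  proof (rule CE_embI)
    show "length (CE_act n \<sigma> f) = n" using CE_emb_length[OF f] by (simp add: CE_act_length)
    show "CE_act n \<sigma> f ! p \<in> disk_emb" if "p < n" for p
      using that s CE_emb_nth[OF f] CE_act_nth[OF CE_emb_length[OF f]] by simp
    show "(CE_act n \<sigma> f ! p) z \<noteq> (CE_act n \<sigma> f ! q) w"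
      if "p < n" "q < n" "p \<noteq> q" "z \<in> disk" "w \<in> disk" for p q z w
      using that s ne CE_emb_disjoint[OF f] CE_act_nth[OF CE_emb_length[OF f]] by simp
  qed
next
  fix i n f m g assume "i < n" "f \<in> CE_emb n" "g \<in> CE_emb m"
  then show "CE_pcomp n m i f g \<in> CE_emb (n + m - 1)" by (rule CE_pcomp_closed)
next
  fix f n assume "f \<in> CE_emb n"
  then show "CE_act n id f = f" by (simp add: CE_act_def)
next
  fix \<sigma> n \<tau> f
  assume "\<sigma> permutes {..<n}" "\<tau> permutes {..<n}" "f \<in> CE_emb n"
  then show "CE_act n (\<sigma> \<circ> \<tau>) f = CE_act n \<tau> (CE_act n \<sigma> f)"
    by (simp add: CE_act_def permute_list_compose CE_emb_length)
next
  fix g m assume g: "g \<in> CE_emb m"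
  have "compose disk (restrict id disk) (g ! p) = g ! p" if "p < m" for p
  proof -
    have "g ! p \<in> disk_emb" using CE_emb_nth[OF g that] .
    then show ?thesis
      by (auto simp: compose_def disk_emb_def image_subset_iff extensional_def fun_eq_iff)
  qed
  then show "CE_pcomp 1 m 0 CE_unit g = g"
    using CE_emb_length[OF g] by (auto simp: CE_pcomp_def CE_unit_def intro!: nth_equalityI)
next
  fix i n f assume i: "i < n" and f: "f \<in> CE_emb n"
  have "compose disk (f ! i) (restrict id disk) = f ! i"
    using CE_emb_nth[OF f i] by (auto simp: compose_def disk_emb_def extensional_def fun_eq_iff)
  then show "CE_pcomp n 1 i f CE_unit = f"
    using i CE_emb_length[OF f] by (simp add: CE_pcomp_def CE_unit_def id_take_nth_drop[symmetric])
next
  fix i l j m f g n h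
  assume i: "i < l" and j: "j < m" and f: "f \<in> CE_emb l" and g: "g \<in> CE_emb m" and h: "h \<in> CE_emb n"
  note len = CE_emb_length[OF f] CE_emb_length[OF g] CE_emb_length[OF h]
  have ij: "i + j < l + m - 1" using i j by simp
  note l1 = CE_pcomp_length[OF len(1,2) i] and l2 = CE_pcomp_length[OF len(2,3) j]
  note n1 = CE_pcomp_nth[OF len(1,2) i] and n2 = CE_pcomp_nth[OF len(2,3) j]
  note n3 = CE_pcomp_nth[OF l1 len(3) ij] and n4 = CE_pcomp_nth[OF len(1) l2 i]
  show "CE_pcomp (l + m - 1) n (i + j) (CE_pcomp l m i f g) h
      = CE_pcomp l (m + n - 1) i f (CE_pcomp m n j g h)"
  proof (rule nth_equalityI, goal_cases)
    case 1
    then show ?case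
      using CE_pcomp_length[OF l1 len(3) ij] CE_pcomp_length[OF len(1) l2 i] i j by simp
  next
    case (2 p)
    then have p: "p < l + m - 1 + n - 1" "p < l + (m + n - 1) - 1"
      using CE_pcomp_length[OF l1 len(3) ij] j by simp_all
    have A: "compose disk (f ! i) (compose disk (g ! j) (h ! q))
        = compose disk (compose disk (f ! i) (g ! j)) (h ! q)" if "q < n" for q
      using compose_disk_assoc CE_emb_nth[OF h that] by blast
    consider "p < i" | "i \<le> p" "p < i + j" | "i + j \<le> p" "p < i + j + n"
      | "i + j + n \<le> p" "p < i + m + n - 1" | "i + j + n \<le> p" "i + m + n - 1 \<le> p"
      by linarith
    then show ?case
    proof cases
      case 1 then show ?thesis using p i j by (simp add: n3 n4 n1)
    next
      case 2
      then have "p - i < j" "p < i + m" "p < i + (m + n - 1)" "p - i < m + n - 1" "p < l + m - 1"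
        using i j by auto
      with 2 show ?thesis using p by (simp add: n3 n4 n1 n2)
    next
      case 3
      then have "p - i - j = p - (i + j)" "p - (i + j) < n" "\<not> p - i < j" "p - i < j + n"
        "\<not> p < i" "p < i + (m + n - 1)" "p - i < m + n - 1" using j by linarith+
      with 3 show ?thesis using p i j by (simp add: n3 n4 n1 n2 A)
    next
      case 4
      then have "p + 1 - n - i = p - i + 1 - n" "\<not> p < i + j" "\<not> p < i + j + n" "\<not> p + 1 - n < i"
        "p + 1 - n < i + m" "p + 1 - n < l + m - 1" "\<not> p < i" "p < i + (m + n - 1)"
        "\<not> p - i < j" "\<not> p - i < j + n" "p - i < m + n - 1"
        using i j by auto
      then show ?thesis using p by (simp only: n3 n4 n1 n2 if_True if_False)
    next
      case 5
      then have "p + 1 - n + 1 - m = p + 1 - (m + n - 1)" "\<not> p < i + j" "\<not> p < i + j + n"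
        "\<not> p + 1 - n < i" "\<not> p + 1 - n < i + m" "p + 1 - n < l + m - 1" "\<not> p < i"
        "\<not> p < i + (m + n - 1)"
        using i j p by auto
      then show ?thesis using p by (simp only: n3 n4 n1 if_True if_False)
    qed
  qed
next
  fix i k l f m g n h
  assume i: "i < k" and k: "k < l" and f: "f \<in> CE_emb l" and g: "g \<in> CE_emb m" and h: "h \<in> CE_emb n"
  note len = CE_emb_length[OF f] CE_emb_length[OF g] CE_emb_length[OF h]
  have il: "i < l" using i k by simp
  have k': "k + m - 1 < l + m - 1" and i': "i < l + n - 1" using i k by auto
  note l1 = CE_pcomp_length[OF len(1,2) il] and l2 = CE_pcomp_length[OF len(1,3) k]
  note n1 = CE_pcomp_nth[OF len(1,2) il] and n2 = CE_pcomp_nth[OF len(1,3) k]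
  note n3 = CE_pcomp_nth[OF l1 len(3) k'] and n4 = CE_pcomp_nth[OF l2 len(2) i']
  show "CE_pcomp (l + m - 1) n (k + m - 1) (CE_pcomp l m i f g) h
      = CE_pcomp (l + n - 1) m i (CE_pcomp l n k f h) g"
  proof (rule nth_equalityI, goal_cases)
    case 1
    then show ?case
      using CE_pcomp_length[OF l1 len(3) k'] CE_pcomp_length[OF l2 len(2) i'] i k by simp
  next
    case (2 p)
    then have p: "p < l + m - 1 + n - 1" "p < l + n - 1 + m - 1"
      using CE_pcomp_length[OF l1 len(3) k'] i k by simp_all
    consider "p < i" | "i \<le> p" "p < i + m" | "i + m \<le> p" "p < k + m - 1"
      | "i + m \<le> p" "k + m - 1 \<le> p" "p < k + m - 1 + n" | "i + m \<le> p" "k + m - 1 + n \<le> p"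
      by linarith
    then show ?case
    proof cases
      case 1
      then have "p < k + m - 1" "p < k" "p < l + m - 1" "p < l + n - 1" using i k by auto
      with 1 show ?thesis using p by (simp only: n3 n4 n1 n2 if_True if_False)
    next
      case 2
      then have "p < k + m - 1" "p < l + m - 1" "\<not> p < i" using i k by auto
      with 2 i show ?thesis using p by (simp only: n3 n4 n1 n2[OF i'] if_True if_False)
    next
      case 3
      then have "p < l + m - 1" "\<not> p < i" "\<not> p < i + m" "p + 1 - m < l + n - 1" "p + 1 - m < k"
        using i k by auto
      with 3 show ?thesis using p by (simp only: n3 n4 n1 n2 if_True if_False)
    next
      case 4
      then have "k + m - 1 + 1 - m = k" "p + 1 - m - k = p - (k + m - 1)" "\<not> p < k + m - 1"
        "\<not> p < i" "\<not> p < i + m" "p + 1 - m < l + n - 1" "\<not> p + 1 - m < k" "p + 1 - m < k + n"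
        "\<not> k + m - 1 < i" "\<not> k + m - 1 < i + m"
        using i k p by auto
      with 4 show ?thesis using p k' by (simp only: n3 n4 n1 n2 if_True if_False)
    next
      case 5
      then have "p + 1 - n + 1 - m = p + 1 - m + 1 - n" "\<not> p < k + m - 1" "\<not> p < k + m - 1 + n"
        "\<not> p < i" "\<not> p < i + m" "p + 1 - m < l + n - 1" "\<not> p + 1 - m < k" "\<not> p + 1 - m < k + n"
        "p + 1 - n < l + m - 1" "\<not> p + 1 - n < i" "\<not> p + 1 - n < i + m"
        using i k p by auto
      with 5 show ?thesis using p by (simp only: n3 n4 n1 n2 if_True if_False)
    qed
  qed
next
  fix i n \<sigma> \<tau> m f g
  assume i: "i < n" and \<sigma>: "\<sigma> permutes {..<n}" and \<tau>: "\<tau> permutes {..<m}"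
    and f: "f \<in> CE_emb n" and g: "g \<in> CE_emb m"
  note len = CE_emb_length[OF f] CE_emb_length[OF g]
  have s: "\<sigma> k < n" if "k < n" for k using permutes_in_image[OF \<sigma>] that by simp
  have t: "\<tau> k < m" if "k < m" for k using permutes_in_image[OF \<tau>] that by simp
  have ne: "\<sigma> k \<noteq> \<sigma> i" if "k \<noteq> i" for k
    using permutes_inj[OF \<sigma>] that by (auto dest: injD)
  have la: "length (CE_act n \<sigma> f) = n" "length (CE_act m \<tau> g) = m"
    using len by (simp_all add: CE_act_length)
  note l1 = CE_pcomp_length[OF len s[OF i]]
  show "CE_pcomp n m i (CE_act n \<sigma> f) (CE_act m \<tau> g)
      = CE_act (n + m - 1) (perm_comp m i \<sigma> \<tau>) (CE_pcomp n m (\<sigma> i) f g)"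
  proof (rule nth_equalityI, goal_cases)
    case 1
    show ?case using CE_pcomp_length[OF la i] l1 by (simp add: CE_act_length)
  next
    case (2 p)
    then have p: "p < n + m - 1" using CE_pcomp_length[OF la i] by simp
    note n1 = CE_pcomp_nth[OF len s[OF i]]
    have shift: "CE_pcomp n m (\<sigma> i) f g ! shift_input m (\<sigma> i) (\<sigma> k) = f ! \<sigma> k"
      if k: "k \<noteq> i" "k < n" for k
    proof (cases "\<sigma> k < \<sigma> i")
      case True
      then have "\<sigma> k < n + m - 1" using s[OF i] by linarith
      then show ?thesis using True by (simp only: shift_input_def n1 if_True)
    next
      case False
      then have "\<sigma> k + m - 1 + 1 - m = \<sigma> k" "\<sigma> k + m - 1 < n + m - 1"
        "\<not> \<sigma> k + m - 1 < \<sigma> i" "\<not> \<sigma> k + m - 1 < \<sigma> i + m"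
        using s[OF k(2)] ne[OF k(1)] by linarith+
      then show ?thesis using False by (simp only: shift_input_def n1 if_False)
    qed
    have "CE_act (n + m - 1) (perm_comp m i \<sigma> \<tau>) (CE_pcomp n m (\<sigma> i) f g) ! p
        = CE_pcomp n m (\<sigma> i) f g ! perm_comp m i \<sigma> \<tau> p"
      using CE_act_nth[OF l1 p] .
    also have "\<dots> = CE_pcomp n m i (CE_act n \<sigma> f) (CE_act m \<tau> g) ! p"
    proof -
      consider "p < i" | "\<not> p < i" "p < i + m" | "\<not> p < i" "\<not> p < i + m" by blast
      then show ?thesis
      proof cases
        case 1
        then show ?thesis
          using i shift[of p] by (simp add: perm_comp_def CE_pcomp_nth[OF la i p] CE_act_nth[OF len(1)])
      next
        case 2
        then have pi: "p - i < m" by linarith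
        then have "\<sigma> i + \<tau> (p - i) < n + m - 1" "\<not> \<sigma> i + \<tau> (p - i) < \<sigma> i"
          "\<sigma> i + \<tau> (p - i) < \<sigma> i + m" "\<sigma> i + \<tau> (p - i) - \<sigma> i = \<tau> (p - i)"
          using s[OF i] t[OF pi] by linarith+
        with 2 show ?thesis
          by (simp only: perm_comp_def CE_pcomp_nth[OF la i p] n1
              CE_act_nth[OF len(1) i] CE_act_nth[OF len(2) pi] if_True if_False)
      next
        case 3
        then have r: "p + 1 - m \<noteq> i" "p + 1 - m < n" using p by linarith+
        show ?thesis
          using 3 by (simp only: perm_comp_def CE_pcomp_nth[OF la i p] shift[OF r]
              CE_act_nth[OF len(1) r(2)] if_False)
      qed
    qed
    finally show ?case ..
  qed
qed

end

theory Submission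
  imports Defs "HOL-Complex_Analysis.Conformal_Mappings"
begin

text \<open>The forms \<open>HS_F\<close> and \<open>HS_G\<close> are built from the single form \<open>dz dw / (z - w)\<^sup>2\<close>: \<open>HS_G \<phi> \<psi>\<close>
  is its pullback along \<open>(\<phi>, \<psi>)\<close>, and \<open>HS_F \<phi>\<close> measures how far it is from being preserved by
  \<open>(\<phi>, \<phi>)\<close>.  Hence they satisfy cocycle identities: \<open>HS_F\<close> of \<open>\<phi> \<circ> g\<close> is the pullback of \<open>HS_F \<phi>\<close> along
  \<open>(g, g)\<close> plus \<open>HS_F g\<close>; \<open>HS_G\<close> of \<open>\<phi> \<circ> g\<close> and \<open>\<phi> \<circ> h\<close> is the pullback of \<open>HS_F \<phi>\<close> along \<open>(g, h)\<close>
  plus \<open>HS_G g h\<close>; and \<open>HS_G\<close> of \<open>\<phi> \<circ> g\<close> and \<open>\<psi> \<circ> h\<close> is the pullback of \<open>HS_G \<phi> \<psi>\<close> along \<open>(g, h)\<close>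
  (\<open>HS_F_compose\<close>, \<open>HS_G_compose_same\<close>, \<open>HS_G_compose\<close>).

  The pullback of \<open>H\<close> along \<open>(g, h)\<close> is \<open>g'(z) h'(w) H(g(z), h(w))\<close>, and \<open>\<bar>g'\<bar>\<^sup>2\<close> is the Jacobian of a
  holomorphic map.  So for injective \<open>g\<close> and \<open>h\<close> the change of variables formula, applied to
  one variable at a time, shows that the \<open>L\<^sup>2\<close> norm does not grow under pullback
  (\<open>square_integrable_on_pullback\<close>).  As \<open>L\<^sup>2\<close> is closed under addition, composites of
  Hilbert--Schmidt embeddings are again such.

  An entry of a partial composition is \<open>f\<^sub>k\<close> or \<open>f\<^sub>i \<circ> g\<^sub>j\<close>; writing \<open>f\<^sub>k\<close> as \<open>f\<^sub>k \<circ> id\<close> makes every entry a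
  composite.  For two different entries, either the outer maps are different entries of \<open>f\<close>, and
  the third identity applies, or both are \<open>f\<^sub>i\<close>, the inner maps are different entries of \<open>g\<close>, and
  the second one applies.\<close>

section \<open>Change of variables for conformal maps\<close>

text \<open>The change of variables theorem speaks about maps of \<open>real^'n\<close>.  It is carried over to the
  complex plane along the identification with \<open>real^2\<close>, which preserves Lebesgue measure.\<close>

definition complex_of_vec :: "real^2 \<Rightarrow> complex" where
  "complex_of_vec v = Complex (v $ 1) (v $ 2)"

definition vec_of_complex :: "complex \<Rightarrow> real^2" where
  "vec_of_complex z = vector [Re z, Im z]"

lemma complex_of_vec_of_complex [simp]: "complex_of_vec (vec_of_complex z) = z"
  by (simp add: complex_of_vec_def vec_of_complex_def)

lemma vec_of_complex_of_vec [simp]: "vec_of_complex (complex_of_vec v) = v"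
  by (simp add: complex_of_vec_def vec_of_complex_def vec_eq_iff forall_2)

lemma linear_complex_of_vec: "linear complex_of_vec"
  by (rule linearI) (simp_all add: complex_of_vec_def complex_eq_iff)

lemma linear_vec_of_complex: "linear vec_of_complex"
  by (rule linearI) (simp_all add: vec_of_complex_def vec_eq_iff forall_2)

lemma borel_measurable_complex_of_vec [measurable]: "complex_of_vec \<in> borel_measurable borel"
  by (intro borel_measurable_continuous_onI linear_continuous_on
      linear_conv_bounded_linear[THEN iffD1] linear_complex_of_vec)

lemma lborel_complex_eq_distr: "lborel = distr lborel borel complex_of_vec"
proof (rule lborel_eqI)
  fix l u :: complex assume lu: "\<And>b. b \<in> Basis \<Longrightarrow> l \<bullet> b \<le> u \<bullet> b"
  let ?l = "vec_of_complex l" and ?u = "vec_of_complex u"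
  have Basis2: "Basis = {axis 1 1, axis 2 1 :: real^2}"
    by (auto simp: Basis_vec_def UNIV_2)
  have ne: "axis 1 1 \<noteq> (axis 2 1 :: real^2)"
    by (simp add: axis_eq_axis)
  have le: "?l \<bullet> b \<le> ?u \<bullet> b" if "b \<in> Basis" for b
    using that lu[of 1] lu[of \<i>]
    by (auto simp: Basis2 Basis_complex_def inner_axis vec_of_complex_def)
  have "complex_of_vec -` box l u = box ?l ?u"
    by (auto simp: complex_of_vec_def vec_of_complex_def mem_box Basis2 Basis_complex_def inner_axis)
  then have "emeasure (distr lborel borel complex_of_vec) (box l u) = emeasure lborel (box ?l ?u)"
    by (simp add: emeasure_distr)
  also have "\<dots> = (\<Prod>b\<in>Basis. (?u - ?l) \<bullet> b)"
    using le by (rule emeasure_lborel_box)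
  also have "(\<Prod>b\<in>Basis. (?u - ?l) \<bullet> b) = (\<Prod>b\<in>Basis. (u - l) \<bullet> b)"
    using ne by (simp add: Basis2 Basis_complex_def inner_axis vec_of_complex_def)
  finally show "emeasure (distr lborel borel complex_of_vec) (box l u) = (\<Prod>b\<in>Basis. (u - l) \<bullet> b)" .
qed simp

lemma nn_integral_lborel_complex:
  assumes "u \<in> borel_measurable borel"
  shows "(\<integral>\<^sup>+z. u z \<partial>lborel) = (\<integral>\<^sup>+v. u (complex_of_vec v) \<partial>lborel)"
  by (subst lborel_complex_eq_distr) (use assms in \<open>simp add: nn_integral_distr\<close>)

lemma emeasure_lborel_complex:
  assumes "A \<in> sets borel"
  shows "emeasure lborel A = emeasure lborel (complex_of_vec -` A)"
  by (subst lborel_complex_eq_distr) (use assms in \<open>simp add: emeasure_distr\<close>)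

text \<open>Together with the Cauchy--Riemann equations, which make the real derivative of a holomorphic map
  a multiplication by a complex number, this identifies its Jacobian.\<close>

lemma det_complex_mult:
  "det (matrix (\<lambda>v. vec_of_complex (c * complex_of_vec v))) = (norm c)\<^sup>2"
  unfolding cmod_power2
  by (simp add: det_2 matrix_def vec_of_complex_def complex_of_vec_def axis_def power2_eq_square)

lemma borel_measurable_holomorphic:
  fixes f :: "complex \<Rightarrow> complex"
  assumes "open U" "f holomorphic_on U"
  shows "(\<lambda>z. indicator U z *\<^sub>R f z) \<in> borel_measurable borel"
  using assms by (intro borel_measurable_continuous_on_indicator holomorphic_on_imp_continuous_on) auto

lemma area_formula_holomorphic:
  assumes U: "open U" and g: "g holomorphic_on U" "inj_on g U"
    and S: "S \<subseteq> U" "S \<in> sets borel" and gS: "g ` S \<in> sets borel" "emeasure lborel (g ` S) < \<infinity>"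
  shows "(\<integral>\<^sup>+z. ennreal ((norm (deriv g z))\<^sup>2) * indicator S z \<partial>lborel) = emeasure lborel (g ` S)"
proof -
  \<comment> \<open>\<open>f\<close>, \<open>f'\<close> and \<open>T\<close> are \<open>g\<close>, its derivative and \<open>S\<close> in real coordinates.\<close>
  define f where "f = (\<lambda>v. vec_of_complex (g (complex_of_vec v)))"
  define f' where "f' v = (\<lambda>h. vec_of_complex (deriv g (complex_of_vec v) * complex_of_vec h))" for v
  define T where "T = complex_of_vec -` S"
  have T [measurable]: "T \<in> sets borel"
    using measurable_sets[OF borel_measurable_complex_of_vec S(2)] by (simp add: T_def)
  have fT: "f ` T = complex_of_vec -` (g ` S)"
  proof (intro equalityI subsetI)
    fix v assume "v \<in> complex_of_vec -` (g ` S)"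
    then obtain z where "z \<in> S" "complex_of_vec v = g z" by auto
    then have "vec_of_complex z \<in> T" "v = f (vec_of_complex z)"
      using vec_of_complex_of_vec[of v] by (simp_all add: T_def f_def)
    then show "v \<in> f ` T" by blast
  qed (auto simp: f_def T_def)
  have fT_meas: "f ` T \<in> sets borel"
    using measurable_sets[OF borel_measurable_complex_of_vec gS(1)] by (simp add: fT)
  have fT_eq: "emeasure lborel (f ` T) = emeasure lborel (g ` S)"
    using emeasure_lborel_complex[OF gS(1)] by (simp add: fT)
  have deriv_f: "(f has_derivative f' v) (at v within T)" if "v \<in> T" for v
  proof -
    have "complex_of_vec v \<in> U" using that S(1) by (auto simp: T_def)
    then have "(g has_field_derivative deriv g (complex_of_vec v)) (at (complex_of_vec v))"
      using U g(1) by (intro holomorphic_derivI)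
    then have "(g has_derivative (*) (deriv g (complex_of_vec v))) (at (complex_of_vec v))"
      by (simp add: has_field_derivative_def)
    moreover have "(complex_of_vec has_derivative complex_of_vec) (at v)"
      "(vec_of_complex has_derivative vec_of_complex) (at (g (complex_of_vec v)))"
      using linear_complex_of_vec linear_vec_of_complex linear_imp_has_derivative by blast+
    ultimately have "(vec_of_complex \<circ> (g \<circ> complex_of_vec) has_derivative
        vec_of_complex \<circ> ((*) (deriv g (complex_of_vec v)) \<circ> complex_of_vec)) (at v)"
      by (intro diff_chain_at) auto
    then show ?thesis
      unfolding f_def f'_def o_def by (rule has_derivative_at_withinI)
  qed
  have inj: "inj_on f T"
  proof (rule inj_onI)
    fix v w assume vw: "v \<in> T" "w \<in> T" "f v = f w"
    then have "g (complex_of_vec v) = g (complex_of_vec w)"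
      unfolding f_def by (metis complex_of_vec_of_complex)
    then have "complex_of_vec v = complex_of_vec w"
      using g(2) vw(1,2) S(1) by (auto simp: T_def dest!: inj_onD)
    then show "v = w" by (metis vec_of_complex_of_vec)
  qed
  have "f ` T \<in> lmeasurable"
    using fT_meas gS(2) fT_eq by (auto simp: fmeasurable_def)
  then have "((\<lambda>v. \<bar>det (matrix (f' v))\<bar>) has_integral measure lebesgue (f ` T)) T"
    using has_measure_differentiable_image[OF _ deriv_f inj, of "measure lebesgue (f ` T)"] by simp
  then have "((\<lambda>v. (norm (deriv g (complex_of_vec v)))\<^sup>2) has_integral measure lebesgue (f ` T)) T"
    by (simp add: f'_def det_complex_mult)
  then have "(\<integral>\<^sup>+v. ennreal ((norm (deriv g (complex_of_vec v)))\<^sup>2) * indicator T v \<partial>lborel)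
      = ennreal (measure lebesgue (f ` T))"
    by (rule nn_integral_has_integral_lebesgue'[rotated]) simp
  also have "\<dots> = emeasure lborel (g ` S)"
    using fT_meas gS(2) by (simp add: fT_eq[symmetric] emeasure_eq_ennreal_measure)
  finally have *: "(\<integral>\<^sup>+v. ennreal ((norm (deriv g (complex_of_vec v)))\<^sup>2) * indicator T v \<partial>lborel)
      = emeasure lborel (g ` S)" .
  have "(\<lambda>z. indicator U z *\<^sub>R deriv g z) \<in> borel_measurable borel"
    using U g(1) by (intro borel_measurable_holomorphic holomorphic_deriv)
  then have "(\<lambda>z. ennreal ((norm (indicator U z *\<^sub>R deriv g z))\<^sup>2) * indicator S z) \<in> borel_measurable borel"
    using S(2) by measurable
  also have "(\<lambda>z. ennreal ((norm (indicator U z *\<^sub>R deriv g z))\<^sup>2) * indicator S z)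
      = (\<lambda>z. ennreal ((norm (deriv g z))\<^sup>2) * indicator S z)"
    using S(1) by (auto simp: fun_eq_iff indicator_def)
  finally show ?thesis
    using * by (simp add: nn_integral_lborel_complex T_def indicator_def)
qed

text \<open>Integrating \<open>u \<circ> g\<close> against \<open>\<bar>g'\<bar>\<^sup>2\<close> is integrating \<open>u\<close> against the image measure under \<open>g\<close>, which
  by the area formula is Lebesgue measure on \<open>g ` U\<close> and so at most Lebesgue measure on the plane.\<close>

lemma nn_integral_holomorphic_substitution_le:
  assumes U: "open U" and g: "g holomorphic_on U" "inj_on g U"
    and u [measurable]: "u \<in> borel_measurable borel"
  shows "(\<integral>\<^sup>+z. ennreal ((norm (deriv g z))\<^sup>2) * u (g z) * indicator U z \<partial>lborel) \<le> (\<integral>\<^sup>+w. u w \<partial>lborel)"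
proof -
  have [measurable]: "U \<in> sets borel" using U by simp
  have "(\<lambda>z. indicator U z *\<^sub>R g z) \<in> borel_measurable borel"
    using U g(1) by (rule borel_measurable_holomorphic)
  moreover define h where "h = (\<lambda>z. indicator U z *\<^sub>R g z)"
  ultimately have h [measurable]: "h \<in> borel_measurable borel" by simp
  have "(\<lambda>z. indicator U z *\<^sub>R deriv g z) \<in> borel_measurable borel"
    using U g(1) by (intro borel_measurable_holomorphic holomorphic_deriv)
  then have "(\<lambda>z. ennreal ((norm (indicator U z *\<^sub>R deriv g z))\<^sup>2)) \<in> borel_measurable borel"
    by measurable
  moreover define J where "J = (\<lambda>z. ennreal ((norm (indicator U z *\<^sub>R deriv g z))\<^sup>2))"
  ultimately have J [measurable]: "J \<in> borel_measurable borel" by simp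
  define N where "N = distr (density lborel J) borel h"
  have sets_N: "sets N = sets lborel" by (simp add: N_def)
  \<comment> \<open>The area formula needs an image of finite measure; the inequality is trivial otherwise.\<close>
  have "emeasure N A \<le> emeasure lborel A" if A: "A \<in> sets borel" for A
  proof (cases "emeasure lborel A = \<infinity>")
    case False
    define S where "S = h -` A \<inter> U"
    have [measurable]: "A \<in> sets borel" by (fact A)
    have S: "S \<in> sets borel"
      unfolding S_def using measurable_sets[OF h A] by auto
    have gS: "g ` S = A \<inter> g ` U"
      by (auto simp: S_def h_def)
    have "open (g ` U)" using g U by (intro open_mapping_thm3)
    then have gS_meas: "g ` S \<in> sets borel" using A gS by auto
    have le: "emeasure lborel (g ` S) \<le> emeasure lborel A"
      using A gS by (intro emeasure_mono) auto
    have "emeasure N A = (\<integral>\<^sup>+z. J z * indicator (h -` A) z \<partial>lborel)"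
      unfolding N_def using A measurable_sets[OF h A] by (simp add: emeasure_distr emeasure_density)
    also have "\<dots> = (\<integral>\<^sup>+z. ennreal ((norm (deriv g z))\<^sup>2) * indicator S z \<partial>lborel)"
      by (intro nn_integral_cong) (auto simp: J_def S_def indicator_def)
    also have "\<dots> = emeasure lborel (g ` S)"
      using le False by (intro area_formula_holomorphic[OF U g _ S gS_meas])
        (auto simp: S_def top.not_eq_extremum)
    finally show ?thesis using le by simp
  qed simp
  then have "N \<le> lborel"
    by (subst le_measure[OF sets_N]) (auto simp: le_fun_def N_def)
  then have "integral\<^sup>N N u \<le> integral\<^sup>N lborel u"
    by (rule nn_integral_mono_measure[OF sets_N])
  also have "integral\<^sup>N N u = (\<integral>\<^sup>+z. J z * u (h z) \<partial>lborel)"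
    by (simp add: N_def nn_integral_distr nn_integral_density)
  also have "\<dots> = (\<integral>\<^sup>+z. ennreal ((norm (deriv g z))\<^sup>2) * u (g z) * indicator U z \<partial>lborel)"
    by (intro nn_integral_cong) (auto simp: J_def h_def indicator_def)
  finally show ?thesis .
qed


section \<open>Square integrability\<close>

lemma borel_measurable_norm_square_indicator:
  fixes h :: "'a::euclidean_space \<Rightarrow> complex"
  assumes "A \<in> sets borel" "h \<in> borel_measurable (restrict_space borel A)"
  shows "(\<lambda>x. ennreal ((norm (h x))\<^sup>2) * indicator A x) \<in> borel_measurable borel"
proof -
  have "(\<lambda>x. indicator A x *\<^sub>R h x) \<in> borel_measurable borel"
    using assms by (simp add: borel_measurable_restrict_space_iff)
  then have "(\<lambda>x. ennreal ((norm (indicator A x *\<^sub>R h x))\<^sup>2)) \<in> borel_measurable borel"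
    by measurable
  also have "(\<lambda>x. ennreal ((norm (indicator A x *\<^sub>R h x))\<^sup>2)) = (\<lambda>x. ennreal ((norm (h x))\<^sup>2) * indicator A x)"
    by (auto simp: fun_eq_iff indicator_def)
  finally show ?thesis .
qed

text \<open>For Borel functions, membership in \<open>L\<^sup>2\<close> is the finiteness of an integral over the Borel measure
  space, where iterated integrals are available.\<close>

lemma square_integrable_on_iff_nn_integral:
  assumes A: "A \<in> sets borel" and h: "h \<in> borel_measurable (restrict_space borel A)"
  shows "h square_integrable_on A \<longleftrightarrow>
    (\<integral>\<^sup>+x. ennreal ((norm (h x))\<^sup>2) * indicator A x \<partial>lborel) < \<infinity>"
proof -
  have "(\<lambda>x. indicator A x *\<^sub>R h x) \<in> borel_measurable lborel"
    using h A by (simp add: borel_measurable_restrict_space_iff)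
  then have "(\<lambda>x. indicator A x *\<^sub>R h x) \<in> borel_measurable lebesgue"
    by (rule measurable_completion)
  then have m [measurable]: "h \<in> borel_measurable (lebesgue_on A)"
    using A by (subst borel_measurable_restrict_space_iff) auto
  have "h square_integrable_on A \<longleftrightarrow> (\<integral>\<^sup>+x. ennreal ((norm (h x))\<^sup>2) \<partial>lebesgue_on A) < \<infinity>"
    using m by (auto simp: square_integrable_on_def integrable_iff_bounded)
  also have "(\<integral>\<^sup>+x. ennreal ((norm (h x))\<^sup>2) \<partial>lebesgue_on A)
      = (\<integral>\<^sup>+x. ennreal ((norm (h x))\<^sup>2) * indicator A x \<partial>lborel)"
    using A by (subst nn_integral_restrict_space) (auto simp: nn_integral_completion)
  finally show ?thesis .
qed

lemma square_integrable_on_cong: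
  assumes "\<And>x. x \<in> A \<Longrightarrow> f x = g x"
  shows "f square_integrable_on A \<longleftrightarrow> g square_integrable_on A"
  unfolding square_integrable_on_def using assms
  by (intro conj_cong measurable_cong Bochner_Integration.integrable_cong) (auto simp: space_restrict_space)

lemma square_integrable_on_add:
  assumes "f square_integrable_on A" "g square_integrable_on A"
  shows "(\<lambda>x. f x + g x) square_integrable_on A"
proof -
  have [measurable]: "f \<in> borel_measurable (lebesgue_on A)" "g \<in> borel_measurable (lebesgue_on A)"
    using assms by (auto simp: square_integrable_on_def)
  have le: "(norm (f x + g x))\<^sup>2 \<le> 2 * (norm (f x))\<^sup>2 + 2 * (norm (g x))\<^sup>2" for x
  proof -
    have "(norm (f x + g x))\<^sup>2 \<le> (norm (f x) + norm (g x))\<^sup>2"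
      by (intro power_mono norm_triangle_ineq) simp
    also have "\<dots> \<le> 2 * (norm (f x))\<^sup>2 + 2 * (norm (g x))\<^sup>2"
      using zero_le_power2[of "norm (f x) - norm (g x)"] by (simp add: power2_sum power2_diff)
    finally show ?thesis .
  qed
  have "integrable (lebesgue_on A) (\<lambda>x. 2 * (norm (f x))\<^sup>2 + 2 * (norm (g x))\<^sup>2)"
    using assms by (auto simp: square_integrable_on_def)
  then have "integrable (lebesgue_on A) (\<lambda>x. (norm (f x + g x))\<^sup>2)"
    by (rule Bochner_Integration.integrable_bound) (use le in auto)
  then show ?thesis by (simp add: square_integrable_on_def)
qed

lemma borel_measurable_holomorphic_coordinates:
  fixes f :: "complex \<Rightarrow> complex"
  shows "f holomorphic_on U \<Longrightarrow> (\<lambda>p. f (fst p)) \<in> borel_measurable (restrict_space borel (U \<times> V))"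
    and "f holomorphic_on V \<Longrightarrow> (\<lambda>p. f (snd p)) \<in> borel_measurable (restrict_space borel (U \<times> V))"
  by (rule borel_measurable_continuous_on_restrict,
      erule continuous_on_compose2[OF holomorphic_on_imp_continuous_on],
      auto intro!: continuous_intros)+

text \<open>The Jacobian of \<open>(\<phi>, \<psi>)\<close> is the product of the Jacobians of \<open>\<phi>\<close> and \<open>\<psi>\<close>, so by Tonelli the
  two variables can be substituted one after the other.\<close>

lemma square_integrable_on_pullback:
  fixes H :: "complex \<times> complex \<Rightarrow> complex"
  assumes U: "open U" "\<phi> holomorphic_on U" "inj_on \<phi> U" "\<phi> ` U \<subseteq> A"
    and V: "open V" "\<psi> holomorphic_on V" "inj_on \<psi> V" "\<psi> ` V \<subseteq> B"
    and AB: "A \<times> B \<in> sets borel"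
    and H: "H \<in> borel_measurable (restrict_space borel (A \<times> B))" "H square_integrable_on A \<times> B"
  shows "(\<lambda>(z, w). deriv \<phi> z * deriv \<psi> w * H (\<phi> z, \<psi> w)) square_integrable_on U \<times> V"
proof -
  let ?K = "\<lambda>(z, w). deriv \<phi> z * deriv \<psi> w * H (\<phi> z, \<psi> w)"
  have UV: "U \<times> V \<in> sets borel" using U(1) V(1) by (simp add: open_Times)
  have map: "(\<lambda>p. (\<phi> (fst p), \<psi> (snd p))) \<in> restrict_space borel (U \<times> V) \<rightarrow>\<^sub>M restrict_space borel (A \<times> B)"
    using U V by (intro measurable_restrict_space2 borel_measurable_Pair
        borel_measurable_holomorphic_coordinates) (auto simp: space_restrict_space)
  have K: "?K \<in> borel_measurable (restrict_space borel (U \<times> V))"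
    unfolding case_prod_unfold
    using U V by (intro borel_measurable_times measurable_compose[OF map H(1)]
        borel_measurable_holomorphic_coordinates holomorphic_deriv)
  define u where "u p = ennreal ((norm (H p))\<^sup>2) * indicator (A \<times> B) p" for p
  have "u \<in> borel_measurable borel"
    unfolding u_def by (rule borel_measurable_norm_square_indicator[OF AB H(1)])
  then have u [measurable]: "u \<in> borel_measurable (borel \<Otimes>\<^sub>M borel)"
    by (simp add: borel_prod)
  have u': "u \<in> borel_measurable (lborel \<Otimes>\<^sub>M lborel)"
    by measurable
  define k where "k p = ennreal ((norm (?K p))\<^sup>2) * indicator (U \<times> V) p" for p
  have "k \<in> borel_measurable borel"
    unfolding k_def by (rule borel_measurable_norm_square_indicator[OF UV K])
  then have k: "k \<in> borel_measurable (lborel \<Otimes>\<^sub>M lborel)"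
    by (simp add: borel_prod lborel_prod)
  define v where "v y = (\<integral>\<^sup>+w. u (y, w) \<partial>lborel)" for y
  have v: "v \<in> borel_measurable borel"
    unfolding v_def by measurable
  have inner: "(\<integral>\<^sup>+w. k (z, w) \<partial>lborel) \<le> ennreal ((norm (deriv \<phi> z))\<^sup>2) * v (\<phi> z) * indicator U z" for z
  proof (cases "z \<in> U")
    case True
    let ?c = "ennreal ((norm (deriv \<phi> z))\<^sup>2)"
    have "(\<integral>\<^sup>+w. k (z, w) \<partial>lborel)
        = (\<integral>\<^sup>+w. ennreal ((norm (deriv \<psi> w))\<^sup>2) * (?c * u (\<phi> z, \<psi> w)) * indicator V w \<partial>lborel)"
      using True U(4) V(4)
      by (intro nn_integral_cong)
        (auto simp: k_def u_def indicator_def norm_mult power_mult_distrib ennreal_mult mult_ac)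
    also have "\<dots> \<le> (\<integral>\<^sup>+w. ?c * u (\<phi> z, w) \<partial>lborel)"
      using V by (intro nn_integral_holomorphic_substitution_le) measurable
    also have "\<dots> = ?c * v (\<phi> z)"
      unfolding v_def by (intro nn_integral_cmult) measurable
    finally show ?thesis using True by simp
  qed (simp add: k_def)
  have "(\<integral>\<^sup>+p. k p \<partial>lborel) = (\<integral>\<^sup>+z. \<integral>\<^sup>+w. k (z, w) \<partial>lborel \<partial>lborel)"
    using lborel.nn_integral_fst[OF k] by (simp add: lborel_prod)
  also have "\<dots> \<le> (\<integral>\<^sup>+z. ennreal ((norm (deriv \<phi> z))\<^sup>2) * v (\<phi> z) * indicator U z \<partial>lborel)"
    by (intro nn_integral_mono inner)
  also have "\<dots> \<le> (\<integral>\<^sup>+z. v z \<partial>lborel)"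
    by (rule nn_integral_holomorphic_substitution_le[OF U(1-3) v])
  also have "\<dots> = (\<integral>\<^sup>+p. u p \<partial>lborel)"
    unfolding v_def using lborel.nn_integral_fst[OF u'] by (simp add: lborel_prod)
  also have "\<dots> < \<infinity>"
    using H(2) square_integrable_on_iff_nn_integral[OF AB H(1)] by (simp add: u_def)
  finally show ?thesis
    using square_integrable_on_iff_nn_integral[OF UV K] by (simp add: k_def)
qed

section \<open>Hilbert--Schmidt embeddings under composition\<close>

lemma disk_emb_holomorphic: "\<phi> \<in> disk_emb \<Longrightarrow> \<phi> holomorphic_on disk"
  by (simp add: disk_emb_def)

lemma deriv_compose_disk:
  assumes \<phi>: "\<phi> \<in> disk_emb" and g: "g \<in> disk_emb" and z: "z \<in> disk"
  shows "deriv (compose disk \<phi> g) z = deriv \<phi> (g z) * deriv g z"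
proof -
  have "(\<phi> has_field_derivative deriv \<phi> (g z)) (at (g z))"
    using disk_emb_mem[OF g z] by (intro holomorphic_derivI[OF disk_emb_holomorphic[OF \<phi>] open_ball])
  moreover have "(g has_field_derivative deriv g z) (at z)"
    using z by (intro holomorphic_derivI[OF disk_emb_holomorphic[OF g] open_ball])
  ultimately have "(\<phi> \<circ> g has_field_derivative deriv \<phi> (g z) * deriv g z) (at z)"
    by (rule DERIV_chain)
  then have "(compose disk \<phi> g has_field_derivative deriv \<phi> (g z) * deriv g z) (at z)"
    by (rule has_field_derivative_transform_within_open[OF _ open_ball z]) (simp add: compose_def)
  then show ?thesis by (rule DERIV_imp_deriv)
qed

text \<open>Adding and subtracting \<open>g'(z) g'(w) / (g(z) - g(w))\<^sup>2\<close> splits the form.  The identity also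
  holds on the diagonal, where the terms with denominator \<open>(g(z) - g(w))\<^sup>2\<close> cancel whatever the value of
  a quotient by \<open>0\<close> is.\<close>

lemma HS_F_compose:
  assumes "\<phi> \<in> disk_emb" "g \<in> disk_emb" "z \<in> disk" "w \<in> disk"
  shows "HS_F (compose disk \<phi> g) (z, w) = deriv g z * deriv g w * HS_F \<phi> (g z, g w) + HS_F g (z, w)"
  using assms by (simp add: HS_F_def deriv_compose_disk compose_eq algebra_simps)

lemma HS_G_compose_same:
  assumes "\<phi> \<in> disk_emb" "g \<in> disk_emb" "h \<in> disk_emb" "z \<in> disk" "w \<in> disk"
  shows "HS_G (compose disk \<phi> g) (compose disk \<phi> h) (z, w)
    = deriv g z * deriv h w * HS_F \<phi> (g z, h w) + HS_G g h (z, w)"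
  using assms by (simp add: HS_F_def HS_G_def deriv_compose_disk compose_eq algebra_simps)

lemma HS_G_compose:
  assumes "\<phi> \<in> disk_emb" "\<psi> \<in> disk_emb" "g \<in> disk_emb" "h \<in> disk_emb" "z \<in> disk" "w \<in> disk"
  shows "HS_G (compose disk \<phi> g) (compose disk \<psi> h) (z, w)
    = deriv g z * deriv h w * HS_G \<phi> \<psi> (g z, h w)"
  using assms by (simp add: HS_G_def deriv_compose_disk compose_eq algebra_simps)

lemma borel_measurable_HS_F:
  assumes "\<phi> \<in> disk_emb"
  shows "HS_F \<phi> \<in> borel_measurable (restrict_space borel (disk \<times> disk))"
  unfolding HS_F_def case_prod_unfold
  using assms by (intro borel_measurable_divide borel_measurable_times borel_measurable_diff
      borel_measurable_power borel_measurable_const borel_measurable_holomorphic_coordinates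
      borel_measurable_holomorphic_coordinates[of "\<lambda>z. z"]
      holomorphic_deriv disk_emb_holomorphic holomorphic_on_ident open_ball)

lemma borel_measurable_HS_G:
  assumes "\<phi> \<in> disk_emb" "\<psi> \<in> disk_emb"
  shows "HS_G \<phi> \<psi> \<in> borel_measurable (restrict_space borel (disk \<times> disk))"
  unfolding HS_G_def case_prod_unfold
  using assms by (intro borel_measurable_divide borel_measurable_times borel_measurable_diff
      borel_measurable_power borel_measurable_holomorphic_coordinates
      holomorphic_deriv disk_emb_holomorphic open_ball)

lemma disk_embs_pullback:
  assumes "g \<in> disk_emb" "h \<in> disk_emb"
    and "H \<in> borel_measurable (restrict_space borel (disk \<times> disk))" "H square_integrable_on disk \<times> disk"
  shows "(\<lambda>(z, w). deriv g z * deriv h w * H (g z, h w)) square_integrable_on disk \<times> disk"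
  using assms
  by (intro square_integrable_on_pullback[where A = disk and B = disk])
    (auto simp: disk_emb_def open_Times simp del: mem_ball mem_ball_0)

lemma compose_disk_HS:
  assumes "\<phi> \<in> disk_HS" "g \<in> disk_HS"
  shows "compose disk \<phi> g \<in> disk_HS"
proof -
  have emb: "\<phi> \<in> disk_emb" "g \<in> disk_emb" using assms by (auto simp: disk_HS_def)
  have "(\<lambda>p. (case p of (z, w) \<Rightarrow> deriv g z * deriv g w * HS_F \<phi> (g z, g w)) + HS_F g p)
      square_integrable_on disk \<times> disk"
    using assms emb by (intro square_integrable_on_add disk_embs_pullback borel_measurable_HS_F)
      (auto simp: disk_HS_def)
  then have "HS_F (compose disk \<phi> g) square_integrable_on disk \<times> disk"
    by (subst square_integrable_on_cong) (auto simp: HS_F_compose[OF emb] simp del: mem_ball mem_ball_0)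
  then show ?thesis
    using compose_disk_emb[OF emb] by (simp add: disk_HS_def)
qed

lemma HS_G_compose_same_square_integrable:
  assumes \<phi>: "\<phi> \<in> disk_HS" and emb: "g \<in> disk_emb" "h \<in> disk_emb"
    and G: "HS_G g h square_integrable_on disk \<times> disk"
  shows "HS_G (compose disk \<phi> g) (compose disk \<phi> h) square_integrable_on disk \<times> disk"
proof -
  have \<phi>': "\<phi> \<in> disk_emb" using \<phi> by (auto simp: disk_HS_def)
  have "(\<lambda>p. (case p of (z, w) \<Rightarrow> deriv g z * deriv h w * HS_F \<phi> (g z, h w)) + HS_G g h p)
      square_integrable_on disk \<times> disk"
    using \<phi> \<phi>' emb G by (intro square_integrable_on_add disk_embs_pullback borel_measurable_HS_F)
      (auto simp: disk_HS_def)
  then show ?thesis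
    by (subst square_integrable_on_cong) (auto simp: HS_G_compose_same[OF \<phi>' emb] simp del: mem_ball mem_ball_0)
qed

lemma HS_G_compose_square_integrable:
  assumes emb: "\<phi> \<in> disk_emb" "\<psi> \<in> disk_emb" "g \<in> disk_emb" "h \<in> disk_emb"
    and G: "HS_G \<phi> \<psi> square_integrable_on disk \<times> disk"
  shows "HS_G (compose disk \<phi> g) (compose disk \<psi> h) square_integrable_on disk \<times> disk"
proof -
  have "(\<lambda>(z, w). deriv g z * deriv h w * HS_G \<phi> \<psi> (g z, h w)) square_integrable_on disk \<times> disk"
    using emb G by (intro disk_embs_pullback borel_measurable_HS_G)
  then show ?thesis
    by (subst square_integrable_on_cong) (auto simp: HS_G_compose[OF emb] simp del: mem_ball mem_ball_0)
qed

text \<open>The identity preserves the form \<open>dz dw / (z - w)\<^sup>2\<close>, so its \<open>HS_F\<close> vanishes.\<close>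

lemma restrict_id_disk_HS: "restrict id disk \<in> disk_HS"
proof -
  have deriv: "deriv (restrict id disk) z = 1" if "z \<in> disk" for z
  proof -
    have "(restrict id disk has_field_derivative 1) (at z)"
      by (rule has_field_derivative_transform_within_open[OF DERIV_ident open_ball that]) simp
    then show ?thesis by (rule DERIV_imp_deriv)
  qed
  have "HS_F (restrict id disk) square_integrable_on disk \<times> disk
      \<longleftrightarrow> (\<lambda>_. 0 :: complex) square_integrable_on disk \<times> disk"
    by (rule square_integrable_on_cong) (auto simp: HS_F_def deriv simp del: mem_ball mem_ball_0)
  then show ?thesis
    using restrict_id_disk_emb by (simp add: disk_HS_def square_integrable_on_def)
qed

lemma compose_disk_restrict_id:
  assumes "\<phi> \<in> disk_emb"
  shows "compose disk \<phi> (restrict id disk) = \<phi>"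
  using assms by (auto simp: compose_def disk_emb_def extensional_def fun_eq_iff)

lemma CE_HSI:
  assumes "fs \<in> CE_emb n" "\<And>i. i < n \<Longrightarrow> fs ! i \<in> disk_HS"
    "\<And>i j. \<lbrakk>i < n; j < n; i \<noteq> j\<rbrakk> \<Longrightarrow> HS_G (fs ! i) (fs ! j) square_integrable_on disk \<times> disk"
  shows "fs \<in> CE_HS n"
  using assms CE_emb_length[OF assms(1)] by (auto simp: CE_HS_def in_set_conv_nth)

lemma CE_HSD:
  assumes "fs \<in> CE_HS n"
  shows "fs \<in> CE_emb n" "i < n \<Longrightarrow> fs ! i \<in> disk_HS" "i < n \<Longrightarrow> fs ! i \<in> disk_emb"
    "\<lbrakk>i < n; j < n; i \<noteq> j\<rbrakk> \<Longrightarrow> HS_G (fs ! i) (fs ! j) square_integrable_on disk \<times> disk"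
  using assms CE_emb_length[of fs n] CE_emb_nth[of fs n] by (auto simp: CE_HS_def in_set_conv_nth subset_iff)

lemma CE_HS_act:
  assumes \<sigma>: "\<sigma> permutes {..<n}" and f: "f \<in> CE_HS n"
  shows "CE_act n \<sigma> f \<in> CE_HS n"
proof (rule CE_HSI)
  have s: "\<sigma> k < n" if "k < n" for k using permutes_in_image[OF \<sigma>] that by simp
  have ne: "\<sigma> k \<noteq> \<sigma> l" if "k \<noteq> l" for k l
    using permutes_inj[OF \<sigma>] that by (auto dest: injD)
  note nth = CE_act_nth[OF CE_emb_length[OF CE_HSD(1)[OF f]]]
  show "CE_act n \<sigma> f \<in> CE_emb n"
    using symmetric_operad.act_closed[OF CE_emb_operad \<sigma> CE_HSD(1)[OF f]] .
  show "CE_act n \<sigma> f ! i \<in> disk_HS" if "i < n" for i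
    using that s CE_HSD(2)[OF f] by (simp add: nth)
  show "HS_G (CE_act n \<sigma> f ! i) (CE_act n \<sigma> f ! j) square_integrable_on disk \<times> disk"
    if "i < n" "j < n" "i \<noteq> j" for i j
    using that s ne CE_HSD(4)[OF f] by (simp add: nth)
qed

text \<open>The position \<open>p\<close> of the composite holds the map \<open>f ! r p\<close> after \<open>u p\<close>, where \<open>u p\<close> is the identity
  off the block of length \<open>m\<close> inserted at \<open>i\<close>.  Two positions with the same \<open>r\<close> lie in this block.\<close>

lemma CE_HS_pcomp:
  assumes i: "i < n" and f: "f \<in> CE_HS n" and g: "g \<in> CE_HS m"
  shows "CE_pcomp n m i f g \<in> CE_HS (n + m - 1)"
proof (rule CE_HSI)
  note f' = CE_HSD[OF f] and g' = CE_HSD[OF g]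
  note nth = CE_pcomp_nth[OF CE_emb_length[OF f'(1)] CE_emb_length[OF g'(1)] i]
  define r where "r p = (if p < i then p else if p < i + m then i else p + 1 - m)" for p
  define u where "u p = (if i \<le> p \<and> p < i + m then g ! (p - i) else restrict id disk)" for p
  have decomp: "CE_pcomp n m i f g ! p = compose disk (f ! r p) (u p)"
    and r: "r p < n" and u: "u p \<in> disk_HS" if "p < n + m - 1" for p
    using that i g'(2) restrict_id_disk_HS f'(3) by (auto simp: nth r_def u_def compose_disk_restrict_id)
  show "CE_pcomp n m i f g \<in> CE_emb (n + m - 1)"
    using i f'(1) g'(1) by (rule CE_pcomp_closed)
  show "CE_pcomp n m i f g ! p \<in> disk_HS" if "p < n + m - 1" for p
    using that by (simp add: decomp compose_disk_HS f'(2) r u)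
  show "HS_G (CE_pcomp n m i f g ! p) (CE_pcomp n m i f g ! q) square_integrable_on disk \<times> disk"
    if pq: "p < n + m - 1" "q < n + m - 1" "p \<noteq> q" for p q
  proof -
    have emb: "u p \<in> disk_emb" "u q \<in> disk_emb"
      using u pq by (auto simp: disk_HS_def)
    show ?thesis
    proof (cases "r p = r q")
      case True
      then have block: "i \<le> p" "p < i + m" "i \<le> q" "q < i + m"
        using pq(3) by (auto simp: r_def split: if_splits)
      then have "HS_G (u p) (u q) square_integrable_on disk \<times> disk"
        using g'(4)[of "p - i" "q - i"] pq(3) by (auto simp: u_def)
      then show ?thesis
        using HS_G_compose_same_square_integrable[OF f'(2)[OF r] emb] pq True by (simp add: decomp)
    next
      case False
      then show ?thesis
        using HS_G_compose_square_integrable[OF f'(3)[OF r] f'(3)[OF r] emb f'(4)[OF r r]] pq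
        by (simp add: decomp)
    qed
  qed
qed

theorem proposition1p10:
  shows "suboperad CE_HS CE_emb CE_act CE_unit CE_pcomp"
proof (intro suboperad.intro suboperad_axioms.intro)
  show "symmetric_operad CE_emb CE_act CE_unit CE_pcomp" by (rule CE_emb_operad)
  show "CE_HS n \<subseteq> CE_emb n" for n by (auto simp: CE_HS_def)
  show "CE_unit \<in> CE_HS 1"
    using restrict_id_disk_HS symmetric_operad.unit_closed[OF CE_emb_operad]
    by (auto simp: CE_HS_def CE_unit_def)
  show "CE_act n \<sigma> f \<in> CE_HS n" if "\<sigma> permutes {..<n}" "f \<in> CE_HS n" for n \<sigma> f
    using that by (rule CE_HS_act)
  show "CE_pcomp n m i f g \<in> CE_HS (n + m - 1)" if "i < n" "f \<in> CE_HS n" "g \<in> CE_HS m" for n m i f g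
    using that by (rule CE_HS_pcomp)
qed

end
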